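(* Let $G$ be a connected graph with $n$ vertices and $n\geq 4$. If $G$ has a $K_{1,2}$-structure-cut, then $$\frac{\kappa(G)}{3}\leq \kappa(G;K_{1,2})\leq \kappa(G).$$ Moreover, the bounds are sharp: there is a connected graph $G$ on at least $4$ vertices having a $K_{1,2}$-structure-cut with $\kappa(G;K_{1,2})=\kappa(G)/3$, and there is a connected graph $G$ on at least $4$ vertices having a $K_{1,2}$-structure-cut with $\kappa(G;K_{1,2})=\kappa(G)$.
   Context: All graphs are finite, simple and undirected. $K_{1,2}$ is the path on three vertices (two edges). A graph is trivial if it has exactly one vertex. The connectivity $\kappa(G)$ of a nontrivial graph $G$ is the minimum, over all pairs of distinct vertices $x,y$, of the maximum number of pairwise internally disjoint $(x,y)$-paths; equivalently, it is the minimum size of a vertex set $S$ such that $G-S$ is disconnected or trivial (so $\kappa(K_n)=n-1$). A $K_{1,2}$-structure-cut of a connected graph $G$ is a set $\mathcal{F}$ of pairwise vertex-disjoint subgraphs of $G$ (not necessarily induced), each isomorphic to $K_{1,2}$, such that $G-V(\mathcal{F})$ (the graph obtained by deleting all vertices of all members of $\mathcal{F}$) is disconnected or trivial. The $K_{1,2}$-structure-connectivity $\kappa(G;K_{1,2})$ is the minimum cardinality of a $K_{1,2}$-structure-cut of $G$. *)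

theory Defs
  imports Complex_Main "Graph_Theory.Graph_Theory"
begin

text \<open>
  A finite simple undirected graph is a \<^locale>\<open>pair_graph\<close>: a finite, loop-free digraph without
  parallel arcs whose arc relation is symmetric, so that an edge is a pair of opposite arcs.
\<close>

definition trivial_graph :: "('a, 'b) pre_digraph \<Rightarrow> bool" where
  "trivial_graph G \<longleftrightarrow> card (verts G) = 1"

text \<open>
  The library's \<^const>\<open>connected\<close> is false for the graph without vertices. Such a graph is not
  regarded as disconnected here (nor is it trivial), hence the first conjunct.
\<close>

definition disconnected :: "('a, 'b) pre_digraph \<Rightarrow> bool" where
  "disconnected G \<longleftrightarrow> verts G \<noteq> {} \<and> \<not> connected G"

definition internally_disjoint_paths ::
  "'a pair_pre_digraph \<Rightarrow> 'a \<Rightarrow> 'a \<Rightarrow> 'a vwalk set \<Rightarrow> bool" where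
  "internally_disjoint_paths G x y P \<longleftrightarrow>
     (\<forall>p\<in>P. vpath p (with_proj G) \<and> hd p = x \<and> last p = y) \<and>
     (\<forall>p\<in>P. \<forall>q\<in>P. p \<noteq> q \<longrightarrow> set p \<inter> set q = {x, y})"

definition max_disjoint_paths :: "'a pair_pre_digraph \<Rightarrow> 'a \<Rightarrow> 'a \<Rightarrow> nat" where
  "max_disjoint_paths G x y = Max {card P | P. internally_disjoint_paths G x y P}"

text \<open>Meaningful only for graphs with at least two vertices.\<close>

definition connectivity :: "'a pair_pre_digraph \<Rightarrow> nat" where
  "connectivity G =
     Min {max_disjoint_paths G x y | x y. x \<in> pverts G \<and> y \<in> pverts G \<and> x \<noteq> y}"

text \<open>
  The members of \<open>F\<close> are subgraphs, not necessarily induced.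
  \<^const>\<open>complete_bipartite_digraph\<close> is closed under isomorphism, so it expresses being isomorphic
  to the complete bipartite graph with parts of sizes 1 and 2.
\<close>

definition K12_structure_cut :: "'a pair_pre_digraph \<Rightarrow> 'a pair_pre_digraph set \<Rightarrow> bool" where
  "K12_structure_cut G F \<longleftrightarrow>
     (\<forall>H\<in>F. subgraph (with_proj H) (with_proj G) \<and> complete_bipartite_digraph 1 2 (with_proj H)) \<and>
     (\<forall>H\<in>F. \<forall>H'\<in>F. H \<noteq> H' \<longrightarrow> pverts H \<inter> pverts H' = {}) \<and>
     (let R = induce_subgraph (with_proj G) (pverts G - (\<Union>H\<in>F. pverts H))
      in disconnected R \<or> trivial_graph R)"

text \<open>Meaningful only for graphs that have such a cut.\<close>

definition K12_structure_connectivity :: "'a pair_pre_digraph \<Rightarrow> nat" where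
  "K12_structure_connectivity G = (LEAST k. \<exists>F. K12_structure_cut G F \<and> card F = k)"

end

theory Submission
  imports Defs
begin

text \<open>
  Lower bound. The members of a structure cut are disjoint and have three vertices each, so \<open>k\<close> of
  them delete \<open>3 * k\<close> vertices. If this leaves two vertices in different components, then every path
  between them meets a deleted vertex, and internally disjoint paths meet different ones. If
  it leaves one vertex, then \<open>3 * k\<close> is one less than the number of vertices and hence at least every
  degree, and the connectivity is at most the minimum degree.

  Upper bound. Let \<open>k\<close> be the connectivity and \<open>n\<close> the number of vertices. Any structure cut has at
  most \<open>n / 3\<close> members, so the given one does if \<open>n \<le> 3 * k + 2\<close>. Otherwise Menger's theorem yields a
  vertex cut \<open>S\<close> of at most \<open>k\<close> vertices that splits the rest into nonempty sides without edges
  between them (\<open>vertex_cut_of_connectivity\<close>). Paths on three vertices are now deleted greedily,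
  each of them inside the union of \<open>S\<close> and the side that is currently larger, and each of them
  meeting \<open>S\<close>, so there are at most \<open>k\<close>. As \<open>n \<ge> 3 * k + 3\<close>, no step uses up the larger side, and
  the smaller side is not touched. If no such path exists, then the graph that is left is already
  disconnected (\<open>disconnected_or_path3_into_larger_side\<close>), and if \<open>S\<close> is used up, the two sides are
  separated.

  The complete graph on four vertices and the star with three leaves show that the bounds are
  sharp: in both, the deletion of one path leaves a single vertex.
\<close>

section \<open>Menger's theorem\<close>

definition separates :: "'a rel \<Rightarrow> 'a set \<Rightarrow> 'a set \<Rightarrow> 'a set \<Rightarrow> bool" where
  "separates E A B X \<longleftrightarrow>
     (\<forall>p. p \<noteq> [] \<and> set (vwalk_arcs p) \<subseteq> E \<and> hd p \<in> A \<and> last p \<in> B \<longrightarrow> set p \<inter> X \<noteq> {})"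

definition linkage :: "'a rel \<Rightarrow> 'a set \<Rightarrow> 'a set \<Rightarrow> 'a list set \<Rightarrow> bool" where
  "linkage E A B L \<longleftrightarrow>
     (\<forall>p\<in>L. p \<noteq> [] \<and> distinct p \<and> set (vwalk_arcs p) \<subseteq> E \<and> hd p \<in> A \<and> last p \<in> B) \<and>
     (\<forall>p\<in>L. \<forall>q\<in>L. p \<noteq> q \<longrightarrow> set p \<inter> set q = {})"

lemma linkageD:
  assumes "linkage E A B L" "p \<in> L"
  shows "p \<noteq> []" "distinct p" "set (vwalk_arcs p) \<subseteq> E" "hd p \<in> A" "last p \<in> B"
  using assms unfolding linkage_def by auto

lemma vwalk_arcs_snoc_subset_prefix:
  "set (vwalk_arcs (u @ [v])) \<subseteq> set (vwalk_arcs (u @ v # w))"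
  using set_vwalk_arcs_append1[of "u @ [v]" w] by simp

lemma fst_arc_in_prefix:
  assumes "(x, y) \<in> set (vwalk_arcs (u @ [v]))"
  shows "x \<in> set u"
  using assms
proof (induction u)
  case (Cons a u)
  then show ?case by (cases u) auto
qed simp

lemma snd_arc_in_suffix:
  assumes "(x, y) \<in> set (vwalk_arcs (v # w))"
  shows "y \<in> set w"
  using assms
proof (induction w arbitrary: v)
  case (Cons a w)
  then show ?case by auto
qed simp

lemma vwalk_arcs_splice:
  assumes "set (vwalk_arcs (u @ [v])) \<subseteq> E" "set (vwalk_arcs (v # w)) \<subseteq> E"
  shows "set (vwalk_arcs (u @ v # w)) \<subseteq> E"
proof (cases "u = []")
  case False
  with assms show ?thesis
    by (simp add: vwalk_arcs_append set_vwalk_arcs_snoc)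
qed (use assms in simp)

lemma separates_insert_arc:
  assumes "separates E A B S" and "z = x \<or> z = y"
  shows "separates (insert (x, y) E) A B (insert z S)"
  unfolding separates_def
proof (intro allI impI, elim conjE)
  fix p assume p: "p \<noteq> []" "set (vwalk_arcs p) \<subseteq> insert (x, y) E" "hd p \<in> A" "last p \<in> B"
  show "set p \<inter> insert z S \<noteq> {}"
  proof (cases "(x, y) \<in> set (vwalk_arcs p)")
    case True
    then show ?thesis using arcs_in_vwalk_arcs[of "(x, y)" p] assms(2) by auto
  next
    case False
    then have "set (vwalk_arcs p) \<subseteq> E" using p(2) by auto
    then show ?thesis using assms(1) p unfolding separates_def by blast
  qed
qed

text \<open>
  Follow a walk up to its first vertex in \<open>insert x S\<close>: this part does not use the arc \<open>(x, y)\<close>,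
  because it would have met \<open>x\<close> earlier.
\<close>

lemma separates_trans_left:
  assumes S: "separates (insert (x, y) E) A B (insert x S)"
    and X: "separates E A (insert x S) X"
  shows "separates (insert (x, y) E) A B X"
  unfolding separates_def
proof (intro allI impI, elim conjE)
  fix p assume p: "p \<noteq> []" "set (vwalk_arcs p) \<subseteq> insert (x, y) E" "hd p \<in> A" "last p \<in> B"
  then have "\<exists>v\<in>set p. v \<in> insert x S" using S unfolding separates_def by blast
  then obtain u v w where uvw: "p = u @ v # w" "v \<in> insert x S" "\<forall>a\<in>set u. a \<notin> insert x S"
    using split_list_first_prop[of p "\<lambda>v. v \<in> insert x S"] by blast
  have "(x, y) \<notin> set (vwalk_arcs (u @ [v]))" using fst_arc_in_prefix uvw(3) by fast
  then have "set (vwalk_arcs (u @ [v])) \<subseteq> E"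
    using p(2) vwalk_arcs_snoc_subset_prefix[of u v w] uvw(1) by blast
  moreover have "hd (u @ [v]) \<in> A" using p(3) uvw(1) by (cases u) auto
  ultimately have "set (u @ [v]) \<inter> X \<noteq> {}"
    using X[unfolded separates_def, rule_format, of "u @ [v]"] uvw(2) by simp
  then show "set p \<inter> X \<noteq> {}" using uvw(1) by auto
qed

lemma separates_trans_right:
  assumes S: "separates (insert (x, y) E) A B (insert y S)"
    and X: "separates E (insert y S) B X"
  shows "separates (insert (x, y) E) A B X"
  unfolding separates_def
proof (intro allI impI, elim conjE)
  fix p assume p: "p \<noteq> []" "set (vwalk_arcs p) \<subseteq> insert (x, y) E" "hd p \<in> A" "last p \<in> B"
  then have "\<exists>v\<in>set p. v \<in> insert y S" using S unfolding separates_def by blast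
  then obtain u v w where uvw: "p = u @ v # w" "v \<in> insert y S" "\<forall>a\<in>set w. a \<notin> insert y S"
    using split_list_last_prop[of p "\<lambda>v. v \<in> insert y S"] by blast
  have "(x, y) \<notin> set (vwalk_arcs (v # w))" using snd_arc_in_suffix uvw(3) by fast
  then have "set (vwalk_arcs (v # w)) \<subseteq> E"
    using p(2) set_vwalk_arcs_append2[of "v # w" u] uvw(1) by blast
  moreover have "last (v # w) \<in> B" using p(4) uvw(1) by simp
  ultimately have "set (v # w) \<inter> X \<noteq> {}"
    using X[unfolded separates_def, rule_format, of "v # w"] uvw(2) by simp
  then show "set p \<inter> X \<noteq> {}" using uvw(1) by auto
qed

text \<open>
  A linkage into \<open>P\<close> with as many paths as \<open>P\<close> has vertices uses every vertex of \<open>P\<close> as an end.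
  As the paths are disjoint, each of them meets \<open>P\<close> only in its own end.
\<close>

lemma linkage_indexed_by_ends:
  assumes L: "linkage E A P L" "finite P" "card L = card P" "finite L"
  obtains f where "\<forall>p\<in>P. f p \<in> L \<and> last (f p) = p" "\<forall>p\<in>P. \<forall>q\<in>P. q \<in> set (f p) \<longrightarrow> p = q"
    "\<forall>p\<in>P. \<forall>q\<in>P. p \<noteq> q \<longrightarrow> set (f p) \<inter> set (f q) = {}"
proof -
  have inj: "inj_on last L"
  proof (rule inj_onI, rule ccontr)
    fix p q assume pq: "p \<in> L" "q \<in> L" "last p = last q" "p \<noteq> q"
    then have "last p \<in> set p \<inter> set q" using L(1) unfolding linkage_def by (metis IntI last_in_set)
    then show False using pq L(1) unfolding linkage_def by blast
  qed
  have "last ` L \<subseteq> P" using L(1) unfolding linkage_def by blast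
  then have im: "last ` L = P" using card_image[OF inj] L by (metis card_subset_eq)
  define f where "f = (\<lambda>p. SOME q. q \<in> L \<and> last q = p)"
  have f: "f p \<in> L \<and> last (f p) = p" if "p \<in> P" for p
    unfolding f_def by (rule someI_ex) (use im that in blast)
  have disj: "set (f p) \<inter> set (f q) = {}" if "p \<in> P" "q \<in> P" "p \<noteq> q" for p q
    using f[OF that(1)] f[OF that(2)] that(3) L(1) unfolding linkage_def by metis
  have "p = q" if "p \<in> P" "q \<in> P" "q \<in> set (f p)" for p q
  proof (rule ccontr)
    assume "p \<noteq> q"
    moreover have "q \<in> set (f q)" using f[OF that(2)] L(1) unfolding linkage_def
      by (metis last_in_set)
    ultimately show False using disj that by blast
  qed
  then show ?thesis using that f disj by blast
qed

lemma linkage_rev: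
  assumes "linkage E A B L"
  shows "linkage (E\<inverse>) B A (rev ` L)"
  using assms unfolding linkage_def
  by (auto simp: set_vwalk_arcs_rev hd_rev last_rev)

lemma linkage_indexed_by_starts:
  assumes L: "linkage E Q B L" "finite Q" "card L = card Q" "finite L"
  obtains g where "\<forall>p\<in>Q. g p \<in> L \<and> hd (g p) = p" "\<forall>p\<in>Q. \<forall>q\<in>Q. q \<in> set (g p) \<longrightarrow> p = q"
    "\<forall>p\<in>Q. \<forall>q\<in>Q. p \<noteq> q \<longrightarrow> set (g p) \<inter> set (g q) = {}"
proof -
  have "card (rev ` L) = card Q" using L(3) by (simp add: card_image)
  then obtain f where f: "\<forall>p\<in>Q. f p \<in> rev ` L \<and> last (f p) = p"
    "\<forall>p\<in>Q. \<forall>q\<in>Q. q \<in> set (f p) \<longrightarrow> p = q"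
    "\<forall>p\<in>Q. \<forall>q\<in>Q. p \<noteq> q \<longrightarrow> set (f p) \<inter> set (f q) = {}"
    using linkage_indexed_by_ends[OF linkage_rev[OF L(1)] L(2) _ finite_imageI[OF L(4)]]
    by metis
  show ?thesis
    by (rule that[of "\<lambda>p. rev (f p)"]) (use f in \<open>auto simp: hd_rev\<close>)
qed

text \<open>
  A vertex common to a path into \<open>P\<close> and a path out of \<open>Q\<close> gives a walk from \<open>A\<close> to \<open>B\<close>, which
  has to meet \<open>S\<close>. The two paths meet \<open>S\<close> at most in their ends, so they share just this end.
\<close>

lemma linkages_meet_in_separator:
  assumes S: "separates E A B S" "S \<subseteq> P" "S \<subseteq> Q"
    and p: "p \<noteq> []" "distinct p" "set (vwalk_arcs p) \<subseteq> E" "hd p \<in> A" "set p \<inter> P \<subseteq> {last p}"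
    and q: "q \<noteq> []" "distinct q" "set (vwalk_arcs q) \<subseteq> E" "last q \<in> B" "set q \<inter> Q \<subseteq> {hd q}"
    and v: "v \<in> set p" "v \<in> set q"
  shows "v = last p \<and> v = hd q \<and> v \<in> S"
proof -
  obtain u1 w1 where 1: "p = u1 @ v # w1" using v(1) by (meson split_list)
  obtain u2 w2 where 2: "q = u2 @ v # w2" using v(2) by (meson split_list)
  have "set (vwalk_arcs (u1 @ v # w2)) \<subseteq> E"
  proof (rule vwalk_arcs_splice)
    show "set (vwalk_arcs (u1 @ [v])) \<subseteq> E"
      using p(3) vwalk_arcs_snoc_subset_prefix[of u1 v w1] unfolding 1 by (rule subset_trans[rotated])
    show "set (vwalk_arcs (v # w2)) \<subseteq> E"
      using q(3) set_vwalk_arcs_append2[of "v # w2" u2] unfolding 2 by (rule subset_trans[rotated])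
  qed
  moreover have "hd (u1 @ v # w2) \<in> A" using p(4) 1 by (cases u1) auto
  moreover have "last (u1 @ v # w2) \<in> B" using q(4) 2 by simp
  ultimately obtain z where z: "z \<in> set (u1 @ v # w2)" "z \<in> S"
    using S(1) unfolding separates_def by blast
  have "v \<in> S"
  proof (cases "z \<in> set (u1 @ [v])")
    case True
    then have "z = last p" using p(5) z(2) S(2) 1 by auto
    with True p(2) 1 have "z = v" by (cases "w1 = []") auto
    with z show ?thesis by simp
  next
    case False
    then have w: "z \<in> set w2" using z(1) by auto
    then have "z = hd q" using q(5) z(2) S(3) 2 by auto
    with w q(2) 2 have False by (cases u2) auto
    then show ?thesis ..
  qed
  then show ?thesis using p(5) q(5) v S(2,3) by blast
qed

text \<open>
  Menger's theorem for arc relations, by induction on the number of arcs. If deleting an arc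
  \<open>(x, y)\<close> makes a set \<open>S\<close> of fewer than \<open>k\<close> vertices a separator, then \<open>insert x S\<close> and
  \<open>insert y S\<close> are separators of size exactly \<open>k\<close>. Without the arc there are still \<open>k\<close> disjoint
  paths from \<open>A\<close> to the first of them and from the second one to \<open>B\<close>; these meet only in \<open>S\<close>
  and are glued there and along the arc.
\<close>

theorem menger:
  assumes "finite E" "finite A" "finite B"
    and "\<And>X. finite X \<Longrightarrow> separates E A B X \<Longrightarrow> k \<le> card X"
  shows "\<exists>L. linkage E A B L \<and> finite L \<and> card L = k"
  using assms
proof (induction E arbitrary: A B rule: finite_induct)
  case empty
  have "p = [hd p]" if "p \<noteq> []" "set (vwalk_arcs p) \<subseteq> {}" for p :: "'a list"
    using that by (cases p rule: vwalk_arcs.cases) auto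
  then have "separates {} A B (A \<inter> B)"
    unfolding separates_def
    by (metis IntI disjoint_iff last_ConsL list.set_sel(1))
  then have "k \<le> card (A \<inter> B)" using empty by simp
  then obtain T where T: "T \<subseteq> A \<inter> B" "finite T" "card T = k"
    by (metis obtain_subset_with_card_n)
  have "linkage {} A B ((\<lambda>a. [a]) ` T)" unfolding linkage_def using T by auto
  moreover have "card ((\<lambda>a. [a]) ` T) = k" using T by (simp add: card_image inj_on_def)
  ultimately show ?case using T(2) by blast
next
  case (insert e E)
  obtain x y where e: "e = (x, y)" by (cases e)
  show ?case
  proof (cases "\<exists>S. finite S \<and> separates E A B S \<and> card S < k")
    case False
    then have "\<exists>L. linkage E A B L \<and> finite L \<and> card L = k"
      using insert.IH insert.prems by (metis not_less)
    then show ?thesis unfolding linkage_def by blast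
  next
    case True
    then obtain S where S: "finite S" "separates E A B S" "card S < k" by blast
    let ?P = "insert x S" and ?Q = "insert y S"
    have sep: "separates (insert (x, y) E) A B ?P" "separates (insert (x, y) E) A B ?Q"
      using separates_insert_arc[OF S(2)] by auto
    then have "k \<le> card ?P" "k \<le> card ?Q" using insert.prems e S(1) by auto
    then have xy: "x \<notin> S" "y \<notin> S" and card: "card ?P = k" "card ?Q = k"
      using S by (auto simp: card_insert_if split: if_splits)
    have "k \<le> card X" if "finite X" "separates E A ?P X" for X
      using insert.prems(3)[OF that(1)] separates_trans_left[OF sep(1) that(2)] e by simp
    then obtain L where L: "linkage E A ?P L" "finite L" "card L = k"
      using insert.IH[of A ?P] insert.prems S(1) by auto
    have "k \<le> card X" if "finite X" "separates E ?Q B X" for X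
      using insert.prems(3)[OF that(1)] separates_trans_right[OF sep(2) that(2)] e by simp
    then obtain M where M: "linkage E ?Q B M" "finite M" "card M = k"
      using insert.IH[of ?Q B] insert.prems S(1) by auto
    obtain f where f: "\<forall>p\<in>?P. f p \<in> L \<and> last (f p) = p"
      "\<forall>p\<in>?P. \<forall>q\<in>?P. q \<in> set (f p) \<longrightarrow> p = q"
      "\<forall>p\<in>?P. \<forall>q\<in>?P. p \<noteq> q \<longrightarrow> set (f p) \<inter> set (f q) = {}"
      using linkage_indexed_by_ends[OF L(1) _ _ L(2)] S(1) L(3) card by (metis finite.insertI)
    obtain g where g: "\<forall>p\<in>?Q. g p \<in> M \<and> hd (g p) = p"
      "\<forall>p\<in>?Q. \<forall>q\<in>?Q. q \<in> set (g p) \<longrightarrow> p = q"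
      "\<forall>p\<in>?Q. \<forall>q\<in>?Q. p \<noteq> q \<longrightarrow> set (g p) \<inter> set (g q) = {}"
      using linkage_indexed_by_starts[OF M(1) _ _ M(2)] S(1) M(3) card by (metis finite.insertI)
    have fp: "f p \<noteq> []" "distinct (f p)" "set (vwalk_arcs (f p)) \<subseteq> E" "hd (f p) \<in> A"
      "last (f p) = p" "set (f p) \<inter> ?P \<subseteq> {last (f p)}" if p: "p \<in> ?P" for p
    proof -
      have fL: "f p \<in> L" "last (f p) = p" using f(1) p by auto
      show "f p \<noteq> []" "distinct (f p)" "set (vwalk_arcs (f p)) \<subseteq> E" "hd (f p) \<in> A"
        using linkageD[OF L(1) fL(1)] by auto
      show "last (f p) = p" by (fact fL(2))
      show "set (f p) \<inter> ?P \<subseteq> {last (f p)}" using f(2) p fL(2) by auto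
    qed
    have gq: "g q \<noteq> []" "distinct (g q)" "set (vwalk_arcs (g q)) \<subseteq> E" "last (g q) \<in> B"
      "hd (g q) = q" "set (g q) \<inter> ?Q \<subseteq> {hd (g q)}" if q: "q \<in> ?Q" for q
    proof -
      have gM: "g q \<in> M" "hd (g q) = q" using g(1) q by auto
      show "g q \<noteq> []" "distinct (g q)" "set (vwalk_arcs (g q)) \<subseteq> E" "last (g q) \<in> B"
        using linkageD[OF M(1) gM(1)] by auto
      show "hd (g q) = q" by (fact gM(2))
      show "set (g q) \<inter> ?Q \<subseteq> {hd (g q)}" using g(2) q gM(2) by auto
    qed
    have meet: "v = p \<and> v = q \<and> v \<in> S"
      if "p \<in> ?P" "q \<in> ?Q" "v \<in> set (f p)" "v \<in> set (g q)" for p q v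
      using linkages_meet_in_separator[OF S(2) subset_insertI subset_insertI
          fp(1-4,6)[OF that(1)] gq(1-4,6)[OF that(2)]
          that(3,4)] fp(5)[OF that(1)] gq(5)[OF that(2)] by auto
    \<comment> \<open>\<open>h p\<close> continues the path to \<open>p\<close> by the path from \<open>s p\<close>, which starts in \<open>p\<close> itself unless
      \<open>p = x\<close>, where the arc \<open>(x, y)\<close> comes in between.\<close>
    define s where "s = (\<lambda>p. if p = x then y else p)"
    define h where "h = (\<lambda>p. f p @ (if p = x then g y else tl (g p)))"
    have h_set: "set (h p) \<subseteq> set (f p) \<union> set (g (s p))" for p
      unfolding h_def s_def by (cases "g p") auto
    have sQ: "s p \<in> ?Q" if "p \<in> ?P" for p using that unfolding s_def by auto
    have fg: "set (f p) \<inter> set (g (s q)) = {}" if pq: "p \<in> ?P" "q \<in> ?P" "p \<noteq> q" for p q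
    proof (rule ccontr)
      assume "set (f p) \<inter> set (g (s q)) \<noteq> {}"
      then obtain v where "v \<in> set (f p)" "v \<in> set (g (s q))" by blast
      then have "v = p \<and> v = s q \<and> v \<in> S" using meet[OF pq(1) sQ[OF pq(2)]] by blast
      then show False using pq(3) xy unfolding s_def by (auto split: if_splits)
    qed
    have disj: "set (h p) \<inter> set (h q) = {}" if pq: "p \<in> ?P" "q \<in> ?P" "p \<noteq> q" for p q
    proof -
      have "s p \<noteq> s q" using pq xy unfolding s_def by auto
      then have "set (g (s p)) \<inter> set (g (s q)) = {}" using g(3) sQ pq by blast
      moreover have "set (f p) \<inter> set (f q) = {}" using f(3) pq by blast
      ultimately show ?thesis
        using fg[OF pq] fg[OF pq(2,1) pq(3)[symmetric]] h_set[of p] h_set[of q] by blast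
    qed
    have path: "h p \<noteq> [] \<and> distinct (h p) \<and> set (vwalk_arcs (h p)) \<subseteq> insert (x, y) E \<and>
        hd (h p) \<in> A \<and> last (h p) \<in> B" if p: "p \<in> ?P" for p
    proof (cases "p = x")
      case True
      have "set (f x) \<inter> set (g y) = {}" using meet[of x y] xy by blast
      then show ?thesis
        using fp[OF p] gq[of y] True unfolding h_def by (auto simp: vwalk_arcs_append)
    next
      case False
      then have pQ: "p \<in> ?Q" using p by auto
      obtain w where w: "g p = p # w" using gq(1,5)[OF pQ] by (metis list.collapse)
      obtain u where u: "f p = u @ [p]" using fp(1,5)[OF p] by (metis append_butlast_last_id)
      have hp: "h p = u @ p # w" unfolding h_def using False u w by simp
      have "set u \<inter> set w = {}"
      proof (rule ccontr)
        assume "set u \<inter> set w \<noteq> {}"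
        then obtain v where "v \<in> set u" "v \<in> set w" by blast
        moreover from this have "v = p" using meet[OF p pQ, of v] u w by auto
        ultimately show False using fp(2)[OF p] u by auto
      qed
      then have "distinct (h p)" using fp(2)[OF p] gq(2)[OF pQ] u w unfolding hp by auto
      moreover have "set (vwalk_arcs (h p)) \<subseteq> E"
        unfolding hp using vwalk_arcs_splice fp(3)[OF p] gq(3)[OF pQ] u w by metis
      moreover have "hd (h p) \<in> A" using fp(4)[OF p] u unfolding hp by (cases u) auto
      moreover have "last (h p) \<in> B" using gq(4)[OF pQ] w unfolding hp by simp
      ultimately show ?thesis unfolding hp by auto
    qed
    have inj: "inj_on h ?P"
    proof (rule inj_onI, rule ccontr)
      fix p q assume "p \<in> ?P" "q \<in> ?P" "h p = h q" "p \<noteq> q"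
      then show False using disj path by (metis Int_absorb set_empty)
    qed
    have "linkage (insert e E) A B (h ` ?P)"
      unfolding linkage_def e using path disj by (metis (no_types, lifting) imageE)
    moreover have "card (h ` ?P) = k" using card_image[OF inj] card(1) by simp
    ultimately show ?thesis using S(1) by blast
  qed
qed

section \<open>Connected and disconnected induced subgraphs\<close>

lemma vwalk_imp_rtrancl:
  assumes "p \<noteq> []" "set (vwalk_arcs p) \<subseteq> E" "set p \<subseteq> R"
  shows "(hd p, last p) \<in> (E \<inter> R \<times> R)\<^sup>*"
  using assms
proof (induction p rule: vwalk_arcs.induct)
  case (3 x y xs)
  then have "(x, y) \<in> E \<inter> R \<times> R" "(y, last (y # xs)) \<in> (E \<inter> R \<times> R)\<^sup>*" by auto
  then show ?case by (auto intro: converse_rtrancl_into_rtrancl)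
qed auto

lemma rtrancl_imp_vwalk:
  assumes "(u, v) \<in> (E \<inter> R \<times> R)\<^sup>*" "u \<in> R"
  shows "\<exists>p. p \<noteq> [] \<and> set (vwalk_arcs p) \<subseteq> E \<and> set p \<subseteq> R \<and> hd p = u \<and> last p = v"
  using assms
proof (induction rule: rtrancl_induct)
  case base
  then show ?case by (intro exI[of _ "[u]"]) auto
next
  case (step v w)
  then obtain p where "p \<noteq> []" "set (vwalk_arcs p) \<subseteq> E" "set p \<subseteq> R" "hd p = u" "last p = v"
    by blast
  with step(2) show ?case by (intro exI[of _ "p @ [w]"]) (auto simp: set_vwalk_arcs_snoc)
qed

context pair_graph
begin

lemma connected_induced_iff:
  "connected (induce_subgraph (with_proj G) R) \<longleftrightarrow>
     R \<noteq> {} \<and> (\<forall>u\<in>R. \<forall>v\<in>R. (u, v) \<in> (parcs G \<inter> R \<times> R)\<^sup>*)"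
proof -
  let ?M = "mk_symmetric (induce_subgraph (with_proj G) R)"
  have arcs: "parcs ?M = parcs G \<inter> R \<times> R"
    unfolding mk_symmetric_def induce_subgraph_def using arcs_symmetric by auto
  have verts: "pverts ?M = R"
    unfolding mk_symmetric_def induce_subgraph_def by simp
  interpret M: pair_wf_digraph ?M
    by unfold_locales (auto simp: arcs verts)
  have "u \<rightarrow>\<^sup>*\<^bsub>with_proj ?M\<^esub> v \<longleftrightarrow> (u, v) \<in> (parcs G \<inter> R \<times> R)\<^sup>*" if "u \<in> R" for u v
    using M.reachable_conv'[of u v] that by (simp add: arcs verts)
  then show ?thesis
    unfolding connected_def strongly_connected_def by (auto simp: verts)
qed

lemma induce_all: "induce_subgraph (with_proj G) (pverts G) = with_proj G"
proof -
  have "{e \<in> parcs G. fst e \<in> pverts G \<and> snd e \<in> pverts G} = parcs G"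
    using arc_fst_in_verts arc_snd_in_verts by blast
  then show ?thesis unfolding induce_subgraph_def with_proj_def by simp
qed

lemma disconnected_induced_iff:
  "disconnected (induce_subgraph (with_proj G) R) \<longleftrightarrow>
     (\<exists>x\<in>R. \<exists>y\<in>R. (x, y) \<notin> (parcs G \<inter> R \<times> R)\<^sup>*)"
  unfolding disconnected_def connected_induced_iff by (auto simp: induce_subgraph_def)

lemma disconnected_inducedI:
  assumes "A \<noteq> {}" "B \<noteq> {}" "A \<inter> B = {}" "\<And>a b. a \<in> A \<Longrightarrow> b \<in> B \<Longrightarrow> (a, b) \<notin> parcs G"
  shows "disconnected (induce_subgraph (with_proj G) (A \<union> B))"
proof -
  obtain a b where ab: "a \<in> A" "b \<in> B" using assms by blast
  have "v \<in> A" if "(a, v) \<in> (parcs G \<inter> (A \<union> B) \<times> (A \<union> B))\<^sup>*" for v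
    using that
  proof (induction rule: rtrancl_induct)
    case base
    then show ?case using ab by blast
  next
    case (step v w)
    then show ?case using assms(4) by blast
  qed
  then have "(a, b) \<notin> (parcs G \<inter> (A \<union> B) \<times> (A \<union> B))\<^sup>*" using ab assms(3) by blast
  then show ?thesis unfolding disconnected_induced_iff using ab by blast
qed

lemma connected_if_universal_vertex:
  assumes "c \<in> pverts G" "\<And>v. v \<in> pverts G \<Longrightarrow> v \<noteq> c \<Longrightarrow> (c, v) \<in> parcs G"
  shows "connected (with_proj G)"
proof -
  let ?E = "parcs G \<inter> pverts G \<times> pverts G"
  have "(c, v) \<in> ?E\<^sup>* \<and> (v, c) \<in> ?E\<^sup>*" if "v \<in> pverts G" for v
    using assms arcs_symmetric[of c v] that by (cases "v = c") auto
  then have "connected (induce_subgraph (with_proj G) (pverts G))"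
    unfolding connected_induced_iff using assms(1) by (blast intro: rtrancl_trans)
  then show ?thesis by (simp only: induce_all)
qed

end

section \<open>Connectivity and vertex cuts\<close>

lemma vpath_with_proj_iff:
  "vpath p (with_proj G) \<longleftrightarrow>
     p \<noteq> [] \<and> distinct p \<and> set p \<subseteq> pverts G \<and> set (vwalk_arcs p) \<subseteq> parcs G"
  unfolding vpath_def vwalk_def by auto

context pair_graph
begin

lemma finite_numbers_of_disjoint_paths:
  "finite {card P | P. internally_disjoint_paths G x y P}"
proof -
  have "finite (Pow {p. set p \<subseteq> pverts G \<and> distinct p})"
    using finite_subset_distinct[OF pair_finite_verts] by simp
  moreover have "P \<in> Pow {p. set p \<subseteq> pverts G \<and> distinct p}"
    if "internally_disjoint_paths G x y P" for P
    using that unfolding internally_disjoint_paths_def vpath_with_proj_iff by auto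
  ultimately have "finite {P. internally_disjoint_paths G x y P}"
    by (metis (no_types, lifting) finite_subset mem_Collect_eq subsetI)
  then show ?thesis by simp
qed

lemma card_le_max_disjoint_paths:
  assumes "internally_disjoint_paths G x y P"
  shows "card P \<le> max_disjoint_paths G x y"
  unfolding max_disjoint_paths_def
  using assms finite_numbers_of_disjoint_paths by (intro Max_ge) auto

lemma max_disjoint_paths_le:
  assumes "\<And>P. internally_disjoint_paths G x y P \<Longrightarrow> card P \<le> n"
  shows "max_disjoint_paths G x y \<le> n"
proof -
  have "internally_disjoint_paths G x y {}" unfolding internally_disjoint_paths_def by simp
  then have "{card P | P. internally_disjoint_paths G x y P} \<noteq> {}" by blast
  then show ?thesis
    unfolding max_disjoint_paths_def using assms finite_numbers_of_disjoint_paths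
    by (subst Max_le_iff) auto
qed

lemma finite_max_disjoint_paths_set:
  "finite {max_disjoint_paths G x y | x y. x \<in> pverts G \<and> y \<in> pverts G \<and> x \<noteq> y}"
proof (rule finite_subset)
  show "finite ((\<lambda>(x, y). max_disjoint_paths G x y) ` (pverts G \<times> pverts G))"
    using pair_finite_verts by simp
qed auto

lemma connectivity_le:
  assumes "x \<in> pverts G" "y \<in> pverts G" "x \<noteq> y"
  shows "connectivity G \<le> max_disjoint_paths G x y"
  unfolding connectivity_def
  by (rule Min_le[OF finite_max_disjoint_paths_set]) (use assms in blast)

lemma connectivity_attained:
  assumes "2 \<le> card (pverts G)"
  obtains x y where "x \<in> pverts G" "y \<in> pverts G" "x \<noteq> y"
    "connectivity G = max_disjoint_paths G x y"
proof -
  let ?M = "{max_disjoint_paths G x y | x y. x \<in> pverts G \<and> y \<in> pverts G \<and> x \<noteq> y}"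
  have "\<not> card (pverts G) \<le> Suc 0" using assms by simp
  then have "?M \<noteq> {}" using card_le_Suc0_iff_eq[OF pair_finite_verts] by blast
  then have "connectivity G \<in> ?M"
    unfolding connectivity_def by (rule Min_in[OF finite_max_disjoint_paths_set])
  then show ?thesis using that by auto
qed

text \<open>
  Different paths have only \<open>x\<close> and \<open>y\<close> in common, so a choice \<open>c\<close> of one vertex from every path is
  injective unless it selects the same end twice.
\<close>

lemma card_disjoint_paths_le:
  assumes P: "internally_disjoint_paths G x y P" and S: "finite S"
    and c: "\<And>p. p \<in> P \<Longrightarrow> c p \<in> set p \<inter> S"
    and ends: "\<And>p q. p \<in> P \<Longrightarrow> q \<in> P \<Longrightarrow> c p = c q \<Longrightarrow> c p \<in> {x, y} \<Longrightarrow> p = q"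
  shows "card P \<le> card S"
proof (rule card_inj_on_le[OF _ _ S])
  show "inj_on c P"
  proof (rule inj_onI, rule ccontr)
    fix p q assume pq: "p \<in> P" "q \<in> P" "c p = c q" "p \<noteq> q"
    then have "c p \<in> set p \<inter> set q" using c[of p] c[of q] by auto
    also have "set p \<inter> set q = {x, y}" using P pq unfolding internally_disjoint_paths_def by blast
    finally show False using ends pq by blast
  qed
  show "c ` P \<subseteq> S" using c by blast
qed

text \<open>
  The second vertices of the paths are neighbours of \<open>x\<close>. They are different, because an inner
  vertex lies on one path only and \<open>y\<close> is the second vertex of no path but the edge \<open>xy\<close>.
\<close>

lemma max_disjoint_paths_le_degree:
  assumes "x \<noteq> y"
  shows "max_disjoint_paths G x y \<le> card {v. (x, v) \<in> parcs G}"
proof (rule max_disjoint_paths_le)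
  fix P assume P: "internally_disjoint_paths G x y P"
  have path: "\<exists>v r. p = x # v # r \<and> (x, v) \<in> parcs G \<and> x \<notin> set (v # r) \<and> distinct (v # r) \<and>
      last (v # r) = y" if p: "p \<in> P" for p
  proof -
    have p: "p \<noteq> []" "distinct p" "set (vwalk_arcs p) \<subseteq> parcs G" "hd p = x" "last p = y"
      using P that unfolding internally_disjoint_paths_def vpath_with_proj_iff by auto
    show ?thesis using p assms by (cases p rule: vwalk_arcs.cases) auto
  qed
  show "card P \<le> card {v. (x, v) \<in> parcs G}"
  proof (rule card_disjoint_paths_le[OF P, where c = "\<lambda>p. hd (tl p)"])
    have "{v. (x, v) \<in> parcs G} \<subseteq> pverts G" using in_arcsD2 by blast
    then show "finite {v. (x, v) \<in> parcs G}" using pair_finite_verts finite_subset by blast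
    show "hd (tl p) \<in> set p \<inter> {v. (x, v) \<in> parcs G}" if "p \<in> P" for p
      using path[OF that] by auto
    show "p = q" if pq: "p \<in> P" "q \<in> P" "hd (tl p) = hd (tl q)" "hd (tl p) \<in> {x, y}" for p q
    proof -
      have "r = [x, y]" if "r \<in> P" "hd (tl r) \<in> {x, y}" for r
      proof -
        obtain v r' where r: "r = x # v # r'" "x \<notin> set (v # r')" "distinct (v # r')"
          "last (v # r') = y" using path[OF \<open>r \<in> P\<close>] by blast
        then have "v = y" using \<open>hd (tl r) \<in> {x, y}\<close> by auto
        then have "r' = []" using r(3,4) by (metis distinct.simps(2) last.simps last_in_set)
        then show ?thesis using r(1) \<open>v = y\<close> by simp
      qed
      then show ?thesis using pq by metis
    qed
  qed
qed

text \<open>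
  If the cut separates \<open>x\<close> from \<open>y\<close>, then every path between them contains a vertex of \<open>S\<close>, and these
  vertices are different. If it leaves a single vertex, then \<open>card S\<close> is at least the degree of every
  vertex.
\<close>

lemma connectivity_le_card_cut:
  assumes V: "2 \<le> card (pverts G)" and S: "S \<subseteq> pverts G"
    and cut: "disconnected (induce_subgraph (with_proj G) (pverts G - S)) \<or>
      trivial_graph (induce_subgraph (with_proj G) (pverts G - S))"
  shows "connectivity G \<le> card S"
  using cut
proof
  have fin: "finite S" using S pair_finite_verts finite_subset by blast
  let ?R = "pverts G - S"
  assume "disconnected (induce_subgraph (with_proj G) ?R)"
  then obtain x y where xy: "x \<in> ?R" "y \<in> ?R" "(x, y) \<notin> (parcs G \<inter> ?R \<times> ?R)\<^sup>*"
    unfolding disconnected_induced_iff by blast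
  have "max_disjoint_paths G x y \<le> card S"
  proof (rule max_disjoint_paths_le)
    fix P assume P: "internally_disjoint_paths G x y P"
    have meets: "set p \<inter> S \<noteq> {}" if "p \<in> P" for p
    proof
      assume "set p \<inter> S = {}"
      then have "p \<noteq> []" "set (vwalk_arcs p) \<subseteq> parcs G" "set p \<subseteq> ?R" "hd p = x" "last p = y"
        using P that unfolding internally_disjoint_paths_def vpath_with_proj_iff by auto
      then show False using vwalk_imp_rtrancl[of p "parcs G" ?R] xy(3) by auto
    qed
    define c where "c = (\<lambda>p. SOME v. v \<in> set p \<inter> S)"
    have c: "c p \<in> set p \<inter> S" if "p \<in> P" for p
      unfolding c_def by (rule someI_ex) (use meets[OF that] in blast)
    show "card P \<le> card S"
      by (rule card_disjoint_paths_le[OF P fin c]) (use c xy in auto)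
  qed
  moreover have "x \<noteq> y" using xy(3) by auto
  ultimately show ?thesis using connectivity_le[of x y] xy by auto
next
  assume "trivial_graph (induce_subgraph (with_proj G) (pverts G - S))"
  then have "card (pverts G - S) = 1"
    unfolding trivial_graph_def induce_subgraph_def by simp
  moreover have "finite S" using S pair_finite_verts finite_subset by blast
  ultimately have card: "card (pverts G) = card S + 1"
    using card_Diff_subset[OF _ S] V by (cases "card S \<le> card (pverts G)") auto
  obtain x y where xy: "x \<in> pverts G" "y \<in> pverts G" "x \<noteq> y"
    "connectivity G = max_disjoint_paths G x y"
    using connectivity_attained[OF V] .
  have "{v. (x, v) \<in> parcs G} \<subseteq> pverts G - {x}"
    using in_arcsD2 no_loops' by blast
  then have "card {v. (x, v) \<in> parcs G} \<le> card (pverts G - {x})"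
    using pair_finite_verts by (intro card_mono) auto
  also have "\<dots> = card S" using card xy(1) by simp
  finally show ?thesis using max_disjoint_paths_le_degree[OF xy(3)] xy(4) by simp
qed

end

section \<open>From disjoint paths to a vertex cut\<close>

lemma vwalk_set_subset:
  assumes "p \<noteq> []" "set (vwalk_arcs p) \<subseteq> U \<times> U" "hd p \<in> U"
  shows "set p \<subseteq> U"
  using assms by (induction p rule: vwalk_arcs.induct) auto

context pair_graph
begin

text \<open>
  Menger's theorem applies to the neighbourhoods of \<open>x\<close> and \<open>y\<close> in the graph without these two
  vertices. The edge \<open>xy\<close>, if it exists, is one more path and survives the deletion of the separator.
\<close>

lemma separator_of_two_vertices:
  assumes xy: "x \<in> pverts G" "y \<in> pverts G" "x \<noteq> y"
  obtains X where "finite X"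
    "separates (parcs G \<inter> (pverts G - {x, y}) \<times> (pverts G - {x, y}))
       ({v. (x, v) \<in> parcs G} - {y}) ({v. (v, y) \<in> parcs G} - {x}) X"
    "card X + (if (x, y) \<in> parcs G then 1 else 0) \<le> max_disjoint_paths G x y"
proof -
  let ?U = "pverts G - {x, y}"
  let ?E = "parcs G \<inter> ?U \<times> ?U"
  let ?A = "{v. (x, v) \<in> parcs G} - {y}" and ?B = "{v. (v, y) \<in> parcs G} - {x}"
  let ?m = "max_disjoint_paths G x y"
  define e where "e = (if (x, y) \<in> parcs G then 1 else 0 :: nat)"
  have A: "?A \<subseteq> ?U" using in_arcsD2 no_loops' by blast
  have B: "?B \<subseteq> ?U" using in_arcsD1 no_loops' by blast
  have "finite ?U" using pair_finite_verts by simp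
  then have fin: "finite ?E" "finite ?A" "finite ?B"
    using finite_subset[OF A] finite_subset[OF B] by auto
  have "\<exists>X. finite X \<and> separates ?E ?A ?B X \<and> card X < ?m + 1 - e"
  proof (rule ccontr)
    assume "\<not> ?thesis"
    then obtain L where L: "linkage ?E ?A ?B L" "finite L" "card L = ?m + 1 - e"
      using menger[OF fin, of "?m + 1 - e"] by (meson not_less)
    let ?f = "\<lambda>p. x # p @ [y]"
    let ?P = "?f ` L \<union> (if (x, y) \<in> parcs G then {[x, y]} else {})"
    have inL: "set p \<subseteq> ?U" if "p \<in> L" for p
      using vwalk_set_subset[of p ?U] linkageD[OF L(1) that] A by blast
    have f: "vpath (?f p) (with_proj G) \<and> hd (?f p) = x \<and> last (?f p) = y" if "p \<in> L" for p
    proof -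
      have p: "p \<noteq> []" "distinct p" "set (vwalk_arcs p) \<subseteq> ?E" "hd p \<in> ?A" "last p \<in> ?B"
        using linkageD[OF L(1) that] by auto
      have "set (vwalk_arcs (?f p)) \<subseteq> parcs G"
        using p by (auto simp: set_vwalk_arcs_snoc)
      then show ?thesis
        unfolding vpath_with_proj_iff using p(2) inL[OF that] xy by auto
    qed
    have "internally_disjoint_paths G x y ?P"
      unfolding internally_disjoint_paths_def
    proof (intro conjI ballI impI)
      fix p assume p: "p \<in> ?P"
      then consider p' where "p' \<in> L" "p = ?f p'" | "p = [x, y]" "(x, y) \<in> parcs G"
        by (auto split: if_splits)
      then have "vpath p (with_proj G) \<and> hd p = x \<and> last p = y"
      proof cases
        case 1
        then show ?thesis using f by blast
      next
        case 2
        then show ?thesis using xy by (auto simp: vpath_with_proj_iff)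
      qed
      then show "vpath p (with_proj G)" "hd p = x" "last p = y" by auto
    next
      fix p q assume pq: "p \<in> ?P" "q \<in> ?P" "p \<noteq> q"
      have "p' = q'" if "p' \<in> L" "q' \<in> L" "v \<in> set p'" "v \<in> set q'" for p' q' v
        using L(1) that unfolding linkage_def by blast
      then show "set p \<inter> set q = {x, y}"
        using pq by (auto split: if_splits)
    qed
    then have "card ?P \<le> ?m" by (rule card_le_max_disjoint_paths)
    moreover have "card ?P = ?m + 1"
    proof -
      have "inj_on ?f L" by (auto simp: inj_on_def)
      then have "card (?f ` L) = ?m + 1 - e" using L(3) by (simp add: card_image)
      moreover have "[x, y] \<notin> ?f ` L" using linkageD(1)[OF L(1)] by auto
      ultimately show ?thesis using L(2) unfolding e_def by auto
    qed
    ultimately show False by simp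
  qed
  then show ?thesis using that unfolding e_def by (auto split: if_splits)
qed

text \<open>
  Every vertex is on the side of \<open>x\<close> if it can be reached from \<open>x\<close> past the separator and without
  the edge \<open>xy\<close>. If that edge exists, one of its ends joins the separator, namely an end
  whose side has a further vertex.
\<close>

lemma vertex_cut_of_connectivity:
  assumes V: "connectivity G + 2 \<le> card (pverts G)"
  obtains A S B where "pverts G = A \<union> S \<union> B" "A \<inter> S = {}" "A \<inter> B = {}" "S \<inter> B = {}"
    "A \<noteq> {}" "B \<noteq> {}" "\<And>a b. a \<in> A \<Longrightarrow> b \<in> B \<Longrightarrow> (a, b) \<notin> parcs G"
    "card S \<le> connectivity G"
proof -
  have "2 \<le> card (pverts G)" using V by simp
  then obtain x y where xy: "x \<in> pverts G" "y \<in> pverts G" "x \<noteq> y"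
    and k: "connectivity G = max_disjoint_paths G x y"
    by (rule connectivity_attained)
  let ?V = "pverts G"
  let ?U = "pverts G - {x, y}"
  let ?E = "parcs G \<inter> ?U \<times> ?U"
  let ?A = "{v. (x, v) \<in> parcs G} - {y}" and ?B = "{v. (v, y) \<in> parcs G} - {x}"
  obtain X where X: "finite X" "separates ?E ?A ?B X"
    "card X + (if (x, y) \<in> parcs G then 1 else 0) \<le> connectivity G"
    using separator_of_two_vertices[OF xy] unfolding k by metis
  have A: "?A \<subseteq> ?U" using in_arcsD2 no_loops' by blast
  define D where "D = {v. \<exists>u\<in>?A - X. (u, v) \<in> rtrancl (?E \<inter> (- X) \<times> (- X))}"
  define Y where "Y = X \<inter> ?U"
  define C where "C = ?V - Y - insert x D"
  have D: "D \<subseteq> ?U - X"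
  proof
    fix v assume "v \<in> D"
    then obtain u where "u \<in> ?A - X" "(u, v) \<in> rtrancl (?E \<inter> (- X) \<times> (- X))"
      unfolding D_def by blast
    from this(2,1) show "v \<in> ?U - X" by (induction rule: rtrancl_induct) (use A in auto)
  qed
  have DB: "v \<notin> ?B" if vD: "v \<in> D" for v
  proof
    assume v: "v \<in> ?B"
    obtain u where u: "u \<in> ?A - X" "(u, v) \<in> rtrancl (?E \<inter> (- X) \<times> (- X))"
      using vD unfolding D_def by blast
    then obtain p where "p \<noteq> []" "set (vwalk_arcs p) \<subseteq> ?E" "set p \<subseteq> - X" "hd p = u" "last p = v"
      using rtrancl_imp_vwalk[of u v ?E "- X"] by blast
    then show False using X(2) u v unfolding separates_def by blast
  qed
  have cardY: "card Y + (if (x, y) \<in> parcs G then 1 else 0) \<le> connectivity G"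
    using card_mono[OF X(1), of Y] X(3) unfolding Y_def by auto
  have finY: "finite Y" unfolding Y_def using X(1) by simp
  have xyY: "x \<notin> Y" "y \<notin> Y" unfolding Y_def by auto
  have yC: "y \<in> C" unfolding C_def using xy xyY D by auto
  have VC: "?V = insert x D \<union> Y \<union> C" unfolding C_def Y_def using D xy by auto
  have xD: "x \<notin> D" "y \<notin> D" using D by auto
  have no_edge: "a = x \<and> b = y" if ab: "a \<in> insert x D" "b \<in> C" "(a, b) \<in> parcs G" for a b
  proof -
    have b: "b \<in> ?V" "b \<notin> Y" "b \<noteq> x" "b \<notin> D" using ab(2) unfolding C_def by auto
    show ?thesis
    proof (cases "a = x")
      case True
      have "b \<in> D" if "b \<noteq> y"
      proof -
        have "b \<in> ?A - X" using that True ab(3) b unfolding Y_def by auto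
        then show ?thesis unfolding D_def by blast
      qed
      then show ?thesis using True b by blast
    next
      case False
      then have a: "a \<in> D" using ab(1) by simp
      then have "b \<noteq> y" using DB[of a] ab(3) False by auto
      then have "(a, b) \<in> ?E \<inter> (- X) \<times> (- X)" using ab(3) b D a unfolding Y_def by auto
      then have "b \<in> D" using a unfolding D_def by (auto intro: rtrancl_into_rtrancl)
      then show ?thesis using b by blast
    qed
  qed
  show ?thesis
  proof (cases "(x, y) \<in> parcs G")
    case False
    show ?thesis
    proof (rule that)
      show "?V = insert x D \<union> Y \<union> C" by (fact VC)
      show "insert x D \<inter> Y = {}" "insert x D \<inter> C = {}" "Y \<inter> C = {}"
        using D xyY unfolding C_def Y_def by auto
      show "C \<noteq> {}" using yC by blast
      show "(a, b) \<notin> parcs G" if "a \<in> insert x D" "b \<in> C" for a b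
        using no_edge[OF that] False by blast
      show "card Y \<le> connectivity G" using cardY by simp
    qed simp
  next
    case True
    then have cardY1: "card Y + 1 \<le> connectivity G" using cardY by simp
    show ?thesis
    proof (cases "D = {}")
      case False
      show ?thesis
      proof (rule that)
        show "?V = D \<union> insert x Y \<union> C" using VC by auto
        show "D \<inter> insert x Y = {}" "D \<inter> C = {}" "insert x Y \<inter> C = {}"
          using D xyY unfolding C_def Y_def by auto
        show "C \<noteq> {}" using yC by blast
        show "(a, b) \<notin> parcs G" if "a \<in> D" "b \<in> C" for a b
          using no_edge[of a b] that xD by blast
        show "card (insert x Y) \<le> connectivity G"
          using cardY1 card_insert_if[OF finY, of x] by (simp split: if_splits)
        show "D \<noteq> {}" by (fact False)
      qed
    next
      case True
      have "C - {y} \<noteq> {}"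
      proof
        assume "C - {y} = {}"
        then have "?V \<subseteq> insert x (insert y Y)" using VC True by auto
        then have "card ?V \<le> card (insert x (insert y Y))" using finY by (intro card_mono) auto
        also have "\<dots> \<le> card Y + 2" using finY by (simp add: card_insert_if)
        finally show False using cardY1 V by simp
      qed
      show ?thesis
      proof (rule that)
        show "?V = insert x D \<union> insert y Y \<union> (C - {y})" using VC yC by auto
        show "insert x D \<inter> insert y Y = {}" "insert x D \<inter> (C - {y}) = {}"
          "insert y Y \<inter> (C - {y}) = {}"
          using D xyY xy unfolding C_def Y_def by auto
        show "(a, b) \<notin> parcs G" if "a \<in> insert x D" "b \<in> C - {y}" for a b
          using no_edge[of a b] that by blast
        show "card (insert y Y) \<le> connectivity G"
          using cardY1 card_insert_if[OF finY, of y] by (simp split: if_splits)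
        show "C - {y} \<noteq> {}" by fact
      qed simp
    qed
  qed
qed

end

section \<open>Cuts that consist of paths on three vertices\<close>

definition path3 :: "'a \<Rightarrow> 'a \<Rightarrow> 'a \<Rightarrow> 'a pair_pre_digraph" where
  "path3 x y z = \<lparr> pverts = {x, y, z}, parcs = {(x, y), (y, x), (y, z), (z, y)} \<rparr>"

lemma pverts_path3 [simp]: "pverts (path3 x y z) = {x, y, z}"
  unfolding path3_def by simp

lemma card_K12:
  assumes "complete_bipartite_digraph 1 2 (with_proj H)"
  shows "card (pverts H) = 3"
proof -
  obtain U W where UW: "pverts H = U \<union> W" "U \<inter> W = {}" "card U = 1" "card W = 2"
    using assms unfolding complete_bipartite_digraph_def with_proj_simps by (elim conjE exE)
  then have "finite U" "finite W" using card.infinite by fastforce+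
  then show ?thesis using UW by (simp add: card_Un_disjoint)
qed

lemma K12_path3:
  assumes "x \<noteq> y" "y \<noteq> z" "x \<noteq> z"
  shows "complete_bipartite_digraph 1 2 (with_proj (path3 x y z))"
proof -
  have "pverts (path3 x y z) = {y} \<union> {x, z}" "{y} \<inter> {x, z} = {}" "card {y} = 1" "card {x, z} = 2"
    "parcs (path3 x y z) = {y} \<times> {x, z} \<union> {x, z} \<times> {y}"
    using assms by (auto simp: path3_def)
  moreover have "finite (pverts (path3 x y z))" by simp
  ultimately show ?thesis
    unfolding complete_bipartite_digraph_pair_def
    by (intro conjI exI[of _ "{y}"] exI[of _ "{x, z}"])
qed

definition K12_packing :: "'a pair_pre_digraph \<Rightarrow> 'a pair_pre_digraph set \<Rightarrow> bool" where
  "K12_packing G F \<longleftrightarrow>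
     (\<forall>H\<in>F. subgraph (with_proj H) (with_proj G) \<and> complete_bipartite_digraph 1 2 (with_proj H)) \<and>
     (\<forall>H\<in>F. \<forall>H'\<in>F. H \<noteq> H' \<longrightarrow> pverts H \<inter> pverts H' = {})"

lemma K12_structure_cut_iff:
  "K12_structure_cut G F \<longleftrightarrow> K12_packing G F \<and>
     (disconnected (induce_subgraph (with_proj G) (pverts G - (\<Union>H\<in>F. pverts H))) \<or>
      trivial_graph (induce_subgraph (with_proj G) (pverts G - (\<Union>H\<in>F. pverts H))))"
  unfolding K12_structure_cut_def K12_packing_def Let_def by (simp only: conj_assoc)

lemma K12_structure_connectivity_le:
  assumes "K12_structure_cut G F"
  shows "K12_structure_connectivity G \<le> card F"
  unfolding K12_structure_connectivity_def by (rule Least_le) (intro exI[of _ F] conjI assms refl)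

lemma K12_structure_connectivity_attained:
  assumes "\<exists>F. K12_structure_cut G F"
  obtains F where "K12_structure_cut G F" "card F = K12_structure_connectivity G"
proof -
  have "\<exists>F. K12_structure_cut G F \<and> card F = K12_structure_connectivity G"
    unfolding K12_structure_connectivity_def by (rule LeastI_ex) (simp add: assms)
  then show ?thesis by (elim exE conjE that)
qed

context pair_graph
begin

lemma subgraph_path3:
  assumes "(x, y) \<in> parcs G" "(y, z) \<in> parcs G"
  shows "subgraph (with_proj (path3 x y z)) (with_proj G)"
proof -
  have "wf_digraph (with_proj (path3 x y z))"
    unfolding wf_digraph_wp_iff by unfold_locales (auto simp: path3_def)
  moreover have "wf_digraph (with_proj G)" ..
  moreover have "{x, y, z} \<subseteq> pverts G" using assms in_arcsD1 in_arcsD2 by blast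
  moreover have "parcs (path3 x y z) \<subseteq> parcs G"
    using assms arcs_symmetric by (auto simp: path3_def)
  ultimately show ?thesis unfolding subgraph_def compatible_def by simp
qed

lemma K12_packing_insert_path3:
  assumes "K12_packing G F" "(x, y) \<in> parcs G" "(y, z) \<in> parcs G" "x \<noteq> z"
    and "\<And>H. H \<in> F \<Longrightarrow> pverts H \<inter> {x, y, z} = {}"
  shows "K12_packing G (insert (path3 x y z) F)"
proof -
  have "x \<noteq> y" "y \<noteq> z" using assms(2,3) no_loops' by auto
  then have "complete_bipartite_digraph 1 2 (with_proj (path3 x y z))"
    by (rule K12_path3[OF _ _ assms(4)])
  moreover have "subgraph (with_proj (path3 x y z)) (with_proj G)"
    by (rule subgraph_path3[OF assms(2,3)])
  moreover have "pverts (path3 x y z) \<inter> pverts H = {}" if "H \<in> F" for H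
    using assms(5)[OF that] by auto
  ultimately show ?thesis using assms(1) unfolding K12_packing_def by (simp add: Int_commute)
qed

lemma card_K12_packing:
  assumes F: "K12_packing G F"
  shows "finite F" "(\<Union>H\<in>F. pverts H) \<subseteq> pverts G" "card (\<Union>H\<in>F. pverts H) = 3 * card F"
proof -
  have sub: "pverts H \<subseteq> pverts G" and three: "card (pverts H) = 3" if "H \<in> F" for H
    using F that card_K12[of H] unfolding K12_packing_def subgraph_def by auto
  then show "(\<Union>H\<in>F. pverts H) \<subseteq> pverts G" by blast
  have "inj_on pverts F"
  proof (rule inj_onI, rule ccontr)
    fix H H' assume H: "H \<in> F" "H' \<in> F" "pverts H = pverts H'" "H \<noteq> H'"
    then have "pverts H = {}" using F unfolding K12_packing_def by blast
    then show False using three[OF H(1)] by simp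
  qed
  moreover have "pverts ` F \<subseteq> Pow (pverts G)" using sub by blast
  ultimately show fin: "finite F"
    using pair_finite_verts by (meson finite_Pow_iff finite_imageD finite_subset)
  have "card (\<Union>H\<in>F. pverts H) = (\<Sum>H\<in>F. card (pverts H))"
  proof (rule card_UN_disjoint[OF fin])
    show "\<forall>H\<in>F. finite (pverts H)" using sub pair_finite_verts finite_subset by blast
    show "\<forall>H\<in>F. \<forall>H'\<in>F. H \<noteq> H' \<longrightarrow> pverts H \<inter> pverts H' = {}"
      using F unfolding K12_packing_def by blast
  qed
  then show "card (\<Union>H\<in>F. pverts H) = 3 * card F" using three by simp
qed

text \<open>
  The vertices of the members form a vertex cut, three for each member.
\<close>

lemma connectivity_le_3_card_structure_cut:
  assumes "2 \<le> card (pverts G)" "K12_structure_cut G F"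
  shows "connectivity G \<le> 3 * card F"
proof -
  note cut = assms(2)[unfolded K12_structure_cut_iff]
  note F = card_K12_packing[OF conjunct1[OF cut]]
  have "connectivity G \<le> card (\<Union>H\<in>F. pverts H)"
    by (rule connectivity_le_card_cut[OF assms(1) F(2) conjunct2[OF cut]])
  then show ?thesis using F(3) by simp
qed

text \<open>
  If no path on three vertices inside \<open>S \<union> B\<close> meets \<open>S\<close>, then every vertex of \<open>S\<close> has at most one
  neighbour in \<open>B\<close>, so \<open>B\<close> has a vertex that is not adjacent to \<open>S\<close>. The vertices of this kind are
  not adjacent to the others in \<open>B\<close> either: a neighbour in \<open>B\<close> of a vertex of \<open>S\<close> would be the middle
  of a path. Hence they are separated from everything else.
\<close>

lemma disconnected_or_path3_into_larger_side:
  assumes disj: "A \<inter> S = {}" "A \<inter> B = {}" "S \<inter> B = {}"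
    and sub: "S \<subseteq> pverts G" "B \<subseteq> pverts G"
    and A: "A \<noteq> {}" and AB: "\<And>a b. a \<in> A \<Longrightarrow> b \<in> B \<Longrightarrow> (a, b) \<notin> parcs G"
    and card: "card S < card B"
  shows "disconnected (induce_subgraph (with_proj G) (A \<union> S \<union> B)) \<or>
    (\<exists>x y z. {x, y, z} \<subseteq> S \<union> B \<and> {x, y, z} \<inter> S \<noteq> {} \<and> x \<noteq> z \<and>
       (x, y) \<in> parcs G \<and> (y, z) \<in> parcs G)"
proof (rule disjCI)
  assume no_path: "\<not> (\<exists>x y z. {x, y, z} \<subseteq> S \<union> B \<and> {x, y, z} \<inter> S \<noteq> {} \<and> x \<noteq> z \<and>
    (x, y) \<in> parcs G \<and> (y, z) \<in> parcs G)"
  have fin: "finite S" "finite B"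
    using sub[THEN finite_subset] pair_finite_verts by auto
  define N where "N = {b \<in> B. \<exists>s\<in>S. (s, b) \<in> parcs G}"
  define c where "c = (\<lambda>b. SOME s. s \<in> S \<and> (s, b) \<in> parcs G)"
  have c: "c b \<in> S" "(c b, b) \<in> parcs G" if "b \<in> N" for b
    using someI_ex[of "\<lambda>s. s \<in> S \<and> (s, b) \<in> parcs G"] that unfolding N_def c_def by auto
  have "inj_on c N"
  proof (rule inj_onI, rule ccontr)
    fix b b' assume b: "b \<in> N" "b' \<in> N" "c b = c b'" "b \<noteq> b'"
    then have "(b, c b) \<in> parcs G" "(c b, b') \<in> parcs G"
      using arcs_symmetric[OF c(2)[OF b(1)]] c(2)[OF b(2)] b(3) by auto
    moreover have "{b, c b, b'} \<subseteq> S \<union> B" "{b, c b, b'} \<inter> S \<noteq> {}" using b c unfolding N_def by auto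
    ultimately show False using no_path b(4) by blast
  qed
  then have "card N \<le> card S" using c fin(1) by (intro card_inj_on_le[of c]) auto
  then have "B - N \<noteq> {}" using card card_mono[of N B] fin(2) unfolding N_def by auto
  have "disconnected (induce_subgraph (with_proj G) ((A \<union> S \<union> N) \<union> (B - N)))"
  proof (rule disconnected_inducedI)
    show "(a, b) \<notin> parcs G" if ab: "a \<in> A \<union> S \<union> N" "b \<in> B - N" for a b
    proof
      assume e: "(a, b) \<in> parcs G"
      then have "a \<in> N" using ab AB unfolding N_def by blast
      then have "{c a, a, b} \<subseteq> S \<union> B" "{c a, a, b} \<inter> S \<noteq> {}" "(c a, a) \<in> parcs G" "c a \<noteq> b"
        using c[of a] ab disj unfolding N_def by auto
      then show False using no_path e by blast
    qed
    show "(A \<union> S \<union> N) \<inter> (B - N) = {}" using disj by auto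
  qed (use A \<open>B - N \<noteq> {}\<close> in auto)
  moreover have "(A \<union> S \<union> N) \<union> (B - N) = A \<union> S \<union> B" unfolding N_def by auto
  ultimately show "disconnected (induce_subgraph (with_proj G) (A \<union> S \<union> B))" by simp
qed

text \<open>
  One step of the greedy deletion. By the cardinality bound, which the step preserves, the larger
  side has at least three vertices if \<open>S\<close> is nonempty; the path takes at most two of them because it
  meets \<open>S\<close>.
\<close>

lemma path3_keeping_both_sides:
  assumes disj: "A \<inter> S = {}" "A \<inter> B = {}" "S \<inter> B = {}"
    and sub: "S \<subseteq> pverts G" "B \<subseteq> pverts G"
    and A: "A \<noteq> {}" and AB: "\<And>a b. a \<in> A \<Longrightarrow> b \<in> B \<Longrightarrow> (a, b) \<notin> parcs G"
    and card: "2 * card S + 3 \<le> card A + card B" and le: "card A \<le> card B"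
    and conn: "\<not> disconnected (induce_subgraph (with_proj G) (A \<union> S \<union> B))"
  obtains x y z where "(x, y) \<in> parcs G" "(y, z) \<in> parcs G" "x \<noteq> z" "{x, y, z} \<subseteq> S \<union> B"
    "card (S - {x, y, z}) < card S" "B - {x, y, z} \<noteq> {}"
    "2 * card (S - {x, y, z}) + 3 \<le> card A + card (B - {x, y, z})"
proof -
  have fin: "finite S" "finite B"
    using sub[THEN finite_subset] pair_finite_verts by auto
  have "card S < card B" using card le by simp
  from disconnected_or_path3_into_larger_side[OF disj sub A AB this] conn
  obtain x y z where xyz: "{x, y, z} \<subseteq> S \<union> B" "{x, y, z} \<inter> S \<noteq> {}" "x \<noteq> z"
    "(x, y) \<in> parcs G" "(y, z) \<in> parcs G"
    by metis
  define T where "T = {x, y, z}"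
  have T: "finite T" "T \<subseteq> S \<union> B" "T \<inter> S \<noteq> {}" unfolding T_def using xyz(1,2) by simp_all
  have "x \<noteq> y" "y \<noteq> z" using no_loops'[OF xyz(4)] no_loops'[OF xyz(5)] by simp_all
  then have "card T = 3" unfolding T_def using xyz(3) by simp
  moreover have "card T = card (T \<inter> S) + card (T \<inter> B)"
  proof -
    have "T = (T \<inter> S) \<union> (T \<inter> B)" "(T \<inter> S) \<inter> (T \<inter> B) = {}" using T(2) disj(3) by auto
    then show ?thesis using card_Un_disjoint[of "T \<inter> S" "T \<inter> B"] T(1) by (metis finite_Int)
  qed
  moreover have "0 < card (T \<inter> S)" using T by (simp add: card_gt_0_iff)
  moreover have "card S = card (T \<inter> S) + card (S - T)" "card B = card (T \<inter> B) + card (B - T)"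
    using card_Int_Diff[OF fin(1), of T] card_Int_Diff[OF fin(2), of T]
    by (simp_all add: Int_commute)
  ultimately have S': "card (S - T) < card S"
    and card': "2 * card (S - T) + 3 \<le> card A + card (B - T)" and "0 < card (B - T)"
    using card le by linarith+
  then have BT: "B - T \<noteq> {}" by (metis card.empty less_irrefl)
  show ?thesis
    by (rule that[OF xyz(4,5,3,1)]) (use S' card' BT in \<open>simp_all add: T_def\<close>)
qed

text \<open>
  Paths on three vertices are removed one after the other, each time from \<open>S\<close> and the larger side.
  This ends when the graph has become disconnected, at the latest when \<open>S\<close> is used up.
\<close>

lemma K12_packing_disconnecting:
  assumes "A \<inter> S = {}" "A \<inter> B = {}" "S \<inter> B = {}" "A \<union> S \<union> B \<subseteq> pverts G"
    and "A \<noteq> {}" "B \<noteq> {}" "\<And>a b. a \<in> A \<Longrightarrow> b \<in> B \<Longrightarrow> (a, b) \<notin> parcs G"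
    and "2 * card S + 3 \<le> card A + card B"
  shows "\<exists>F. K12_packing G F \<and> (\<Union>H\<in>F. pverts H) \<subseteq> A \<union> S \<union> B \<and> card F \<le> card S \<and>
    disconnected (induce_subgraph (with_proj G) (A \<union> S \<union> B - (\<Union>H\<in>F. pverts H)))"
  using assms
proof (induction "card S" arbitrary: A S B rule: less_induct)
  case less
  show ?case
  proof (cases "disconnected (induce_subgraph (with_proj G) (A \<union> S \<union> B))")
    case True
    then show ?thesis by (intro exI[of _ "{}"]) (simp add: K12_packing_def)
  next
    case False
    have BA: "\<And>b a. b \<in> B \<Longrightarrow> a \<in> A \<Longrightarrow> (b, a) \<notin> parcs G"
      using less.prems(7) arcs_symmetric by metis
    obtain P Q where PQ: "P \<union> S \<union> Q = A \<union> S \<union> B" "P \<inter> S = {}" "P \<inter> Q = {}" "S \<inter> Q = {}"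
      "P \<noteq> {}" "\<And>a b. a \<in> P \<Longrightarrow> b \<in> Q \<Longrightarrow> (a, b) \<notin> parcs G"
      "2 * card S + 3 \<le> card P + card Q" "card P \<le> card Q"
    proof (cases "card A \<le> card B")
      case True
      then show ?thesis using that[of A B] less.prems by simp
    next
      case False
      show ?thesis
        by (rule that[of B A])
          (use less.prems BA False in \<open>simp_all add: Int_commute Un_ac\<close>)
    qed
    have sub: "P \<subseteq> pverts G" "S \<subseteq> pverts G" "Q \<subseteq> pverts G" using PQ(1) less.prems(4) by auto
    have conn: "\<not> disconnected (induce_subgraph (with_proj G) (P \<union> S \<union> Q))"
      using False PQ(1) by simp
    obtain x y z where xyz: "(x, y) \<in> parcs G" "(y, z) \<in> parcs G" "x \<noteq> z"
      "{x, y, z} \<subseteq> S \<union> Q" "card (S - {x, y, z}) < card S" "Q - {x, y, z} \<noteq> {}"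
      "2 * card (S - {x, y, z}) + 3 \<le> card P + card (Q - {x, y, z})"
      by (rule path3_keeping_both_sides[OF PQ(2-4) sub(2,3) PQ(5-8) conn])
    define T where "T = {x, y, z}"
    have TP: "T \<inter> P = {}" using xyz(4) PQ(2,3) unfolding T_def by auto
    let ?R = "P \<union> (S - T) \<union> (Q - T)"
    have "\<exists>F. K12_packing G F \<and> (\<Union>H\<in>F. pverts H) \<subseteq> ?R \<and> card F \<le> card (S - T) \<and>
      disconnected (induce_subgraph (with_proj G) (?R - (\<Union>H\<in>F. pverts H)))"
    proof (rule less.hyps)
      show "P \<inter> (S - T) = {}" "P \<inter> (Q - T) = {}" "(S - T) \<inter> (Q - T) = {}" "?R \<subseteq> pverts G"
        using PQ(2-4) sub by auto
      show "(a, b) \<notin> parcs G" if "a \<in> P" "b \<in> Q - T" for a b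
        using PQ(6)[of a b] that by simp
    qed (use xyz PQ(5) in \<open>simp_all add: T_def\<close>)
    then obtain F where F: "K12_packing G F" "(\<Union>H\<in>F. pverts H) \<subseteq> ?R"
      "card F \<le> card (S - T)"
      "disconnected (induce_subgraph (with_proj G) (?R - (\<Union>H\<in>F. pverts H)))"
      by (elim exE conjE)
    let ?F = "insert (path3 x y z) F"
    have pack: "K12_packing G ?F"
    proof (rule K12_packing_insert_path3[OF F(1) xyz(1-3)])
      show "pverts H \<inter> {x, y, z} = {}" if "H \<in> F" for H
        using F(2) that TP unfolding T_def by blast
    qed
    have union: "(\<Union>H\<in>?F. pverts H) = T \<union> (\<Union>H\<in>F. pverts H)" by (simp add: T_def)
    have sub': "(\<Union>H\<in>?F. pverts H) \<subseteq> A \<union> S \<union> B"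
      unfolding union PQ(1)[symmetric] using F(2) xyz(4) unfolding T_def by blast
    have card: "card ?F \<le> card S"
      using F(3) xyz(5) card_insert_le_m1[of "card S" F "path3 x y z"] by (simp add: T_def)
    have "A \<union> S \<union> B - (\<Union>H\<in>?F. pverts H) = ?R - (\<Union>H\<in>F. pverts H)"
      unfolding union PQ(1)[symmetric] using TP by blast
    then have "disconnected (induce_subgraph (with_proj G) (A \<union> S \<union> B - (\<Union>H\<in>?F. pverts H)))"
      using F(4) by (simp only:)
    then show ?thesis using pack sub' card by (intro exI[of _ ?F] conjI)
  qed
qed

text \<open>
  A given structure cut has at most a third of the vertices as members. This is at most the
  connectivity \<open>k\<close> if there are at most \<open>3 * k + 2\<close> vertices; otherwise there is enough
  room for the greedy deletion along a vertex cut of at most \<open>k\<close> vertices.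
\<close>

lemma K12_structure_connectivity_le_connectivity:
  assumes F0: "K12_structure_cut G F0"
  shows "K12_structure_connectivity G \<le> connectivity G"
proof (cases "card (pverts G) \<le> 3 * connectivity G + 2")
  case True
  note F = card_K12_packing[OF conjunct1[OF F0[unfolded K12_structure_cut_iff]]]
  have "3 * card F0 \<le> card (pverts G)"
    using card_mono[OF pair_finite_verts F(2)] F(3) by simp
  then have "card F0 \<le> connectivity G" using True by simp
  then show ?thesis using K12_structure_connectivity_le[OF F0] by simp
next
  case False
  then have "connectivity G + 2 \<le> card (pverts G)" by simp
  then obtain A S B where ASB: "pverts G = A \<union> S \<union> B" "A \<inter> S = {}" "A \<inter> B = {}" "S \<inter> B = {}"
    "A \<noteq> {}" "B \<noteq> {}" "\<And>a b. a \<in> A \<Longrightarrow> b \<in> B \<Longrightarrow> (a, b) \<notin> parcs G"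
    and S: "card S \<le> connectivity G"
    by (rule vertex_cut_of_connectivity) blast
  have "finite A" "finite S" "finite B" using pair_finite_verts ASB(1) by auto
  then have "card (pverts G) = card A + card S + card B"
    using ASB(1-4) by (simp add: card_Un_disjoint Int_Un_distrib2)
  then have "2 * card S + 3 \<le> card A + card B" using False S by simp
  then have "\<exists>F. K12_packing G F \<and> (\<Union>H\<in>F. pverts H) \<subseteq> A \<union> S \<union> B \<and> card F \<le> card S \<and>
    disconnected (induce_subgraph (with_proj G) (A \<union> S \<union> B - (\<Union>H\<in>F. pverts H)))"
    by (intro K12_packing_disconnecting ASB(2-7)) (simp_all add: ASB(1))
  then obtain F where F: "K12_packing G F" "card F \<le> card S"
    "disconnected (induce_subgraph (with_proj G) (A \<union> S \<union> B - (\<Union>H\<in>F. pverts H)))"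
    by (elim exE conjE)
  have "K12_structure_cut G F"
    unfolding K12_structure_cut_iff ASB(1) by (intro conjI F(1) disjI1 F(3))
  then show ?thesis using K12_structure_connectivity_le F(2) S by (meson le_trans)
qed

lemma K12_structure_connectivity_bounds:
  assumes "2 \<le> card (pverts G)" "\<exists>F. K12_structure_cut G F"
  shows "connectivity G \<le> 3 * K12_structure_connectivity G"
    and "K12_structure_connectivity G \<le> connectivity G"
proof -
  obtain F where F: "K12_structure_cut G F" "card F = K12_structure_connectivity G"
    using K12_structure_connectivity_attained[OF assms(2)] .
  show "connectivity G \<le> 3 * K12_structure_connectivity G"
    using connectivity_le_3_card_structure_cut[OF assms(1) F(1)] F(2) by simp
  show "K12_structure_connectivity G \<le> connectivity G"
    by (rule K12_structure_connectivity_le_connectivity[OF F(1)])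
qed

lemma K12_structure_cut_path3:
  assumes "(x, y) \<in> parcs G" "(y, z) \<in> parcs G" "x \<noteq> z" "card (pverts G) = 4"
  shows "K12_structure_cut G {path3 x y z}"
proof -
  have pack: "K12_packing G {path3 x y z}"
    using K12_packing_insert_path3[OF _ assms(1-3), of "{}"] by (simp add: K12_packing_def)
  note F = card_K12_packing[OF pack]
  have "card (pverts G - (\<Union>H\<in>{path3 x y z}. pverts H)) = 1"
    using card_Diff_subset[OF finite_subset[OF F(2) pair_finite_verts] F(2)] F(3) assms(4)
    by simp
  then have "trivial_graph (induce_subgraph (with_proj G)
      (pverts G - (\<Union>H\<in>{path3 x y z}. pverts H)))"
    unfolding trivial_graph_def induce_subgraph_def by simp
  with pack show ?thesis unfolding K12_structure_cut_iff by (intro conjI disjI2)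
qed

text \<open>In a complete graph every third vertex gives a path from \<open>x\<close> to \<open>y\<close>, besides the edge \<open>xy\<close>.\<close>

lemma connectivity_complete:
  assumes "2 \<le> card (pverts G)"
    and complete: "\<And>u v. u \<in> pverts G \<Longrightarrow> v \<in> pverts G \<Longrightarrow> u \<noteq> v \<Longrightarrow> (u, v) \<in> parcs G"
  shows "card (pverts G) - 1 \<le> connectivity G"
proof -
  obtain x y where xy: "x \<in> pverts G" "y \<in> pverts G" "x \<noteq> y"
    "connectivity G = max_disjoint_paths G x y"
    using connectivity_attained[OF assms(1)] .
  let ?T = "(\<lambda>v. [x, v, y]) ` (pverts G - {x, y})"
  have "internally_disjoint_paths G x y (insert [x, y] ?T)"
    unfolding internally_disjoint_paths_def vpath_with_proj_iff using xy complete by auto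
  then have "card (insert [x, y] ?T) \<le> connectivity G"
    using card_le_max_disjoint_paths xy(4) by simp
  moreover have "card ?T = card (pverts G) - 2"
  proof -
    have "card ?T = card (pverts G - {x, y})" by (rule card_image) (simp add: inj_on_def)
    then show ?thesis using card_Diff_subset[of "{x, y}" "pverts G"] xy(1-3) by simp
  qed
  moreover have "[x, y] \<notin> ?T" "finite ?T" using pair_finite_verts by auto
  ultimately show ?thesis using assms(1) by simp
qed

end

section \<open>Sharpness\<close>

definition K4 :: "nat pair_pre_digraph" where
  "K4 = \<lparr> pverts = {0, 1, 2, 3}, parcs = {(u, v). u \<in> {0, 1, 2, 3} \<and> v \<in> {0, 1, 2, 3} \<and> u \<noteq> v} \<rparr>"

definition K13 :: "nat pair_pre_digraph" where
  "K13 = \<lparr> pverts = {0, 1, 2, 3}, parcs = {0} \<times> {1, 2, 3} \<union> {1, 2, 3} \<times> {0} \<rparr>"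

lemma pair_graphI:
  assumes "finite (pverts G)" "\<And>u v. (u, v) \<in> parcs G \<Longrightarrow> u \<in> pverts G \<and> v \<in> pverts G \<and> u \<noteq> v"
    and "sym (parcs G)"
  shows "pair_graph G"
proof
  have "parcs G \<subseteq> pverts G \<times> pverts G" using assms(2) by auto
  then show "finite (parcs G)" using assms(1) finite_subset by blast
  show "symmetric (with_proj G)" unfolding symmetric_def using assms(3) by simp
qed (use assms(1,2) in auto)

text \<open>
  The connectivity is three and one path suffices for a structure cut; the general lower bound turns
  these two estimates into equalities.
\<close>

lemma K4_sharp:
  "pair_graph K4" "connected (with_proj K4)" "card (pverts K4) = 4" "\<exists>F. K12_structure_cut K4 F"
  "connectivity K4 = 3 * K12_structure_connectivity K4"
proof -
  show G: "pair_graph K4" by (rule pair_graphI) (auto simp: K4_def sym_def)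
  interpret pair_graph K4 by (rule G)
  show card: "card (pverts K4) = 4" by (simp add: K4_def)
  show "connected (with_proj K4)"
    by (rule connected_if_universal_vertex[of 0]) (auto simp: K4_def)
  have cut: "K12_structure_cut K4 {path3 0 1 2}"
    by (rule K12_structure_cut_path3) (simp_all add: card, simp_all add: K4_def)
  then show ex: "\<exists>F. K12_structure_cut K4 F" by blast
  have "card (pverts K4) - 1 \<le> connectivity K4"
    by (rule connectivity_complete) (auto simp: K4_def)
  moreover have "K12_structure_connectivity K4 \<le> 1"
    using K12_structure_connectivity_le[OF cut] by simp
  ultimately show "connectivity K4 = 3 * K12_structure_connectivity K4"
    using K12_structure_connectivity_bounds(1)[OF _ ex] card by simp
qed

text \<open>
  A leaf has degree one, so the connectivity of the star is at most one; and no connected graph with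
  several vertices has an empty structure cut.
\<close>

lemma K13_sharp:
  "pair_graph K13" "connected (with_proj K13)" "card (pverts K13) = 4" "\<exists>F. K12_structure_cut K13 F"
  "K12_structure_connectivity K13 = connectivity K13"
proof -
  show G: "pair_graph K13" by (rule pair_graphI) (auto simp: K13_def sym_def)
  interpret pair_graph K13 by (rule G)
  show card: "card (pverts K13) = 4" by (simp add: K13_def)
  show conn: "connected (with_proj K13)"
    by (rule connected_if_universal_vertex[of 0]) (auto simp: K13_def)
  have "K12_structure_cut K13 {path3 1 0 2}"
    by (rule K12_structure_cut_path3) (simp_all add: card, simp_all add: K13_def)
  then show ex: "\<exists>F. K12_structure_cut K13 F" by blast
  have "connectivity K13 \<le> max_disjoint_paths K13 1 2"
    by (rule connectivity_le) (simp_all add: K13_def)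
  also have "\<dots> \<le> card {v. (1, v) \<in> parcs K13}" by (rule max_disjoint_paths_le_degree) simp
  also have "{v. (1, v) \<in> parcs K13} = {0}" by (auto simp: K13_def)
  finally have "connectivity K13 \<le> 1" by simp
  moreover have "K12_structure_connectivity K13 \<noteq> 0"
  proof
    assume "K12_structure_connectivity K13 = 0"
    then obtain F where F: "K12_structure_cut K13 F" "card F = 0"
      using K12_structure_connectivity_attained[OF ex] by metis
    then have "F = {}"
      using card_K12_packing(1)[OF conjunct1[OF F(1)[unfolded K12_structure_cut_iff]]] by simp
    then have "disconnected (with_proj K13) \<or> trivial_graph (with_proj K13)"
      using F(1) unfolding K12_structure_cut_iff by (simp add: induce_all)
    then show False using conn card unfolding disconnected_def trivial_graph_def by simp
  qed
  ultimately show "K12_structure_connectivity K13 = connectivity K13"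
    using K12_structure_connectivity_bounds(2)[OF _ ex] card by simp
qed

theorem theorem4p2:
  shows "(\<forall>G :: 'a pair_pre_digraph.
            pair_graph G \<and> connected (with_proj G) \<and> card (pverts G) \<ge> 4 \<and>
            (\<exists>F. K12_structure_cut G F) \<longrightarrow>
              real (connectivity G) / 3 \<le> real (K12_structure_connectivity G) \<and>
              K12_structure_connectivity G \<le> connectivity G) \<and>
         (\<exists>G :: nat pair_pre_digraph.
            pair_graph G \<and> connected (with_proj G) \<and> card (pverts G) \<ge> 4 \<and>
            (\<exists>F. K12_structure_cut G F) \<and>
            real (K12_structure_connectivity G) = real (connectivity G) / 3) \<and>
         (\<exists>G :: nat pair_pre_digraph.
            pair_graph G \<and> connected (with_proj G) \<and> card (pverts G) \<ge> 4 \<and>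
            (\<exists>F. K12_structure_cut G F) \<and>
            K12_structure_connectivity G = connectivity G)"
proof (intro conjI allI impI)
  fix G :: "'a pair_pre_digraph"
  assume "pair_graph G \<and> connected (with_proj G) \<and> card (pverts G) \<ge> 4 \<and>
    (\<exists>F. K12_structure_cut G F)"
  then have G: "pair_graph G" "2 \<le> card (pverts G)" "\<exists>F. K12_structure_cut G F" by auto
  note bounds = pair_graph.K12_structure_connectivity_bounds[OF G]
  show "real (connectivity G) / 3 \<le> real (K12_structure_connectivity G)"
    using bounds(1) by simp
  show "K12_structure_connectivity G \<le> connectivity G"
    by (rule bounds(2))
next
  have "real (K12_structure_connectivity K4) = real (connectivity K4) / 3"
    using K4_sharp(5) by simp
  then show "\<exists>G :: nat pair_pre_digraph.
      pair_graph G \<and> connected (with_proj G) \<and> card (pverts G) \<ge> 4 \<and>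
      (\<exists>F. K12_structure_cut G F) \<and>
      real (K12_structure_connectivity G) = real (connectivity G) / 3"
    by (intro exI[of _ K4] conjI K4_sharp(1,2,4)) (simp_all add: K4_sharp(3))
next
  show "\<exists>G :: nat pair_pre_digraph.
      pair_graph G \<and> connected (with_proj G) \<and> card (pverts G) \<ge> 4 \<and>
      (\<exists>F. K12_structure_cut G F) \<and>
      K12_structure_connectivity G = connectivity G"
    by (intro exI[of _ K13] conjI K13_sharp(1,2,4,5)) (simp add: K13_sharp(3))
qed

end
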